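(* Let $(X,r)$ be a finite solution of the Yang--Baxter equation. Then there is a finite left brace $(B,+,\cdot)$ such that $X\subseteq B$ and $X$ generates the additive group $(B,+)$. Moreover, $(X,r)$ is a subsolution of the solution $(B,\sigma)$ associated canonically with the left brace $B$, that is, $X$ is $\sigma$-invariant ($\sigma(X\times X)\subseteq X\times X$) and $r=\sigma_{|X\times X}$ is the restriction of $\sigma$ to $X\times X$.
   Context: A solution of the Yang--Baxter equation is a pair $(X,r)$ with $X$ a non-empty set and $r\colon X\times X\to X\times X$, $r(x,y)=({}^{x}y,x^{y})$, such that $r_{12}r_{23}r_{12}=r_{23}r_{12}r_{23}$ on $X^3$ (where $r_{12}=r\times\mathrm{id}_X$, $r_{23}=\mathrm{id}_X\times r$), $r^2=\mathrm{id}$ (involutive), and for every $x\in X$ the maps $y\mapsto{}^{x}y$ and $y\mapsto y^{x}$ are bijective (non-degenerate). It is finite if $X$ is finite. A left brace is a set $B$ with two operations $+$ and $\cdot$ such that $(B,+)$ is an abelian group, $(B,\cdot)$ is a group, and $a\cdot(b+c)+a=a\cdot b+a\cdot c$ for all $a,b,c\in B$. For $a\in B$ let $\mathcal{L}_a\colon B\to B$, $\mathcal{L}_a(b)=a\cdot b-a$; each $\mathcal{L}_a$ is an automorphism of $(B,+)$. The solution associated with a left brace $B$ is $(B,\sigma)$ with $\sigma(a,b)=(\mathcal{L}_a(b),\mathcal{L}^{-1}_{\mathcal{L}_a(b)}(a))$. The inclusion $X\subseteq B$ is understood via identification of $X$ with its image under an injective map $X\to B$. *)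

theory Defs
  imports "HOL-Algebra.Ring" "HOL-Algebra.Generated_Groups"
begin

definition on12 :: "('a \<times> 'a \<Rightarrow> 'a \<times> 'a) \<Rightarrow> 'a \<times> 'a \<times> 'a \<Rightarrow> 'a \<times> 'a \<times> 'a" where
  "on12 r = (\<lambda>(x, y, z). case r (x, y) of (u, v) \<Rightarrow> (u, v, z))"

definition on23 :: "('a \<times> 'a \<Rightarrow> 'a \<times> 'a) \<Rightarrow> 'a \<times> 'a \<times> 'a \<Rightarrow> 'a \<times> 'a \<times> 'a" where
  "on23 r = (\<lambda>(x, y, z). (x, r (y, z)))"

(* Only the values of r on X \<times> X are constrained.  In nondeg_right the varying
   argument is the first one: the map y |-> y^x is y |-> snd (r (y, x)). *)
locale yb_solution =
  fixes X :: "'a set" and r :: "'a \<times> 'a \<Rightarrow> 'a \<times> 'a"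
  assumes nonempty: "X \<noteq> {}"
    and maps: "r \<in> X \<times> X \<rightarrow> X \<times> X"
    and braid: "t \<in> X \<times> X \<times> X \<Longrightarrow>
      on12 r (on23 r (on12 r t)) = on23 r (on12 r (on23 r t))"
    and involutive: "p \<in> X \<times> X \<Longrightarrow> r (r p) = p"
    and nondeg_left: "x \<in> X \<Longrightarrow> bij_betw (\<lambda>y. fst (r (x, y))) X X"
    and nondeg_right: "x \<in> X \<Longrightarrow> bij_betw (\<lambda>y. snd (r (y, x))) X X"

(* The ring record only serves as the signature with two operations; a left brace
   is in general not a ring. *)
locale left_brace = abelian_group B + group B for B (structure) +
  assumes brace_distrib: "\<lbrakk>a \<in> carrier B; b \<in> carrier B; c \<in> carrier B\<rbrakk> \<Longrightarrow>
    a \<otimes> (b \<oplus> c) \<oplus> a = a \<otimes> b \<oplus> a \<otimes> c"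

definition brace_lambda :: "('b, 'm) ring_scheme \<Rightarrow> 'b \<Rightarrow> 'b \<Rightarrow> 'b" where
  "brace_lambda B a b = (a \<otimes>\<^bsub>B\<^esub> b) \<ominus>\<^bsub>B\<^esub> a"

definition brace_sol :: "('b, 'm) ring_scheme \<Rightarrow> 'b \<times> 'b \<Rightarrow> 'b \<times> 'b" where
  "brace_sol B = (\<lambda>(a, b).
     (brace_lambda B a b,
      inv_into (carrier B) (brace_lambda B (brace_lambda B a b)) a))"

(* (X, r), identified with its image under the injection i, is a subsolution of (Y, s). *)
definition subsolution_via ::
    "('a \<Rightarrow> 'b) \<Rightarrow> 'a set \<Rightarrow> ('a \<times> 'a \<Rightarrow> 'a \<times> 'a) \<Rightarrow> 'b set \<Rightarrow> ('b \<times> 'b \<Rightarrow> 'b \<times> 'b) \<Rightarrow> bool" where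
  "subsolution_via i X r Y s \<longleftrightarrow>
     inj_on i X \<and> i ` X \<subseteq> Y \<and>
     s ` (i ` X \<times> i ` X) \<subseteq> i ` X \<times> i ` X \<and>
     (\<forall>x\<in>X. \<forall>y\<in>X. s (i x, i y) = map_prod i i (r (x, y)))"

end

theory Submission
  imports Defs "HOL-Library.Multiset" "HOL-Combinatorics.Perm"
begin

text \<open>
  Write \<open>\<sigma> x\<close> for the permutation \<open>y \<mapsto> fst (r (x, y))\<close> of \<open>X\<close>. The braid relation and involutivity
  imply Rump's cycle set identity \<open>\<sigma> x * \<sigma> (\<sigma> x\<inverse> y) = \<sigma> y * \<sigma> (\<sigma> y\<inverse> x)\<close> (\<open>sigma_cycle\<close>). This
  symmetry in \<open>x\<close> and \<open>y\<close> makes the maps \<open>step y : p \<mapsto> p * \<sigma> (p\<inverse> y)\<close> on permutations commute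
  (\<open>step_commute\<close>), so that a multiset \<open>M\<close> over \<open>X\<close> acts on permutations by performing \<open>step y\<close> for
  all its elements \<open>y\<close>, in any order. Let \<open>\<lambda> M\<close> (formally \<open>lam M\<close>) be the image of the
  identity under this action; then \<open>\<lambda> {#x#} = \<sigma> x\<close>. Since \<open>step (p z) (p * q) = p * step z q\<close>, the
  operation \<open>M \<circ> N = M + \<lambda> M (N)\<close> (formally \<open>circ M N\<close>) satisfies \<open>\<lambda> (M \<circ> N) = \<lambda> M * \<lambda> N\<close>
  (\<open>lam_circ\<close>). Associativity of \<open>\<circ>\<close> and the brace law follow at once: the multisets form a left
  brace except that inverses are missing.

  Inverses come from reduction modulo a period. By the right non-degeneracy of \<open>r\<close> the map
  \<open>x \<mapsto> \<sigma> x\<inverse> x\<close> is injective (\<open>sigma_diagonal\<close>), whence every \<open>step y\<close> is injective; as it acts on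
  the finite set of permutations of \<open>X\<close>, it has finite order there. If \<open>m \<ge> 2\<close> is a common period
  (\<open>common_period\<close>), then \<open>\<lambda> M\<close> depends only on the multiplicities modulo \<open>m\<close> (\<open>lam_cong\<close>), both
  operations descend to \<open>(\<int>/m)\<^sup>X\<close>, and \<open>m \<ge> 2\<close> keeps distinct generators apart. In the resulting
  finite brace the product of \<open>x\<close> and \<open>y\<close> is \<open>c + x\<close> and that of \<open>c\<close> and \<open>d\<close> is \<open>x + c\<close> whenever
  \<open>r (x, y) = (c, d)\<close>, and these two equations determine the value of the canonical solution at
  \<open>(x, y)\<close> (\<open>brace_sol_eqI\<close>).
\<close>

unbundle permutation_syntax

section \<open>Recognising the solution of a left brace\<close>

text \<open>The equations are \<open>\<L> a b = c\<close> and \<open>\<L> c d = a\<close> with the subtraction moved to the other side. In this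
  form they involve only sums and products, which makes them easy to verify in
  a quotient.\<close>

lemma (in left_brace) brace_sol_eqI:
  assumes carr: "a \<in> carrier B" "b \<in> carrier B" "c \<in> carrier B" "d \<in> carrier B"
    and ab: "a \<otimes> b = c \<oplus> a" and cd: "c \<otimes> d = a \<oplus> c"
  shows "brace_sol B (a, b) = (c, d)"
proof -
  have lam_ab: "brace_lambda B a b = c"
    using carr by (simp add: brace_lambda_def ab minus_eq a_assoc r_neg)
  have lam_cd: "brace_lambda B c d = a"
    using carr by (simp add: brace_lambda_def cd minus_eq a_assoc r_neg)
  have "inj_on (brace_lambda B c) (carrier B)"
    using carr by (auto intro!: inj_onI simp: brace_lambda_def minus_eq)
  then have "inv_into (carrier B) (brace_lambda B c) a = d"
    using carr lam_cd by (metis inv_into_f_f)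
  then show ?thesis
    by (simp add: brace_sol_def lam_ab)
qed

section \<open>Permutations and multisets\<close>

lemma perm_inverse_apply [simp]: "inverse p \<langle>$\<rangle> (p \<langle>$\<rangle> x) = x"
  by (simp add: apply_sequence)

lemma perm_apply_inverse [simp]: "p \<langle>$\<rangle> (inverse p \<langle>$\<rangle> x) = x"
  by (simp add: apply_sequence)

lemma perm_apply_mem:
  assumes "affected p \<subseteq> X" "x \<in> X"
  shows "p \<langle>$\<rangle> x \<in> X"
  using assms by (metis apply_affected in_affected subsetD)

lemma finite_perms_on:
  assumes "finite X"
  shows "finite {p :: 'a perm. affected p \<subseteq> X}"
proof (rule finite_imageD)
  let ?P = "{p :: 'a perm. affected p \<subseteq> X}" and ?g = "\<lambda>p. restrict (apply p) X"
  have "?g ` ?P \<subseteq> X \<rightarrow>\<^sub>E X"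
    by (auto intro: perm_apply_mem)
  then show "finite (?g ` ?P)"
    by (rule finite_subset) (simp add: finite_PiE assms)
  show "inj_on ?g ?P"
  proof (rule inj_onI, rule perm_eqI)
    fix p q x assume p: "p \<in> ?P" and q: "q \<in> ?P" and eq: "?g p = ?g q"
    show "p \<langle>$\<rangle> x = q \<langle>$\<rangle> x"
    proof (cases "x \<in> X")
      case True
      then show ?thesis using fun_cong[OF eq, of x] by simp
    next
      case False
      with p q have "x \<notin> affected p" "x \<notin> affected q" by auto
      then show ?thesis by (simp add: in_affected)
    qed
  qed
qed

lemma count_image_perm: "count (image_mset (apply p) M) x = count M (inverse p \<langle>$\<rangle> x)"
  by (induction M) auto

lemma mset_quotient_remainder:
  fixes M :: "'a multiset" and m :: nat
  obtains R Q where "\<And>x. count R x = count M x mod m" "M = R + repeat_mset m Q"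
proof -
  have "finite {x. 0 < count M x mod m}" "finite {x. 0 < count M x div m}"
    by (rule finite_subset[OF _ finite_set_mset[of M]]; force simp: not_in_iff intro: ccontr)+
  then have "count (Abs_multiset (\<lambda>x. count M x mod m)) = (\<lambda>x. count M x mod m)"
      "count (Abs_multiset (\<lambda>x. count M x div m)) = (\<lambda>x. count M x div m)"
    by simp_all
  then show thesis
    by (intro that[of "Abs_multiset (\<lambda>x. count M x mod m)" "Abs_multiset (\<lambda>x. count M x div m)"])
      (auto intro!: multiset_eqI)
qed

lemma set_repeat_mset_subset: "set_mset (repeat_mset n M) \<subseteq> set_mset M"
  by (induction n) auto

lemma funpow_fixpoint_mult:
  assumes "(f ^^ k) x = x"
  shows "(f ^^ (k * n)) x = x"
  by (induction n) (simp_all add: funpow_add assms)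

section \<open>Cycle sets and the brace structure on multisets\<close>

text \<open>A non-degenerate cycle set on the finite set \<open>X\<close>, given by the inverses \<open>\<sigma> x\<close>
  (here \<open>s x\<close>) of its left translations. Extending every \<open>\<sigma> x\<close> by the identity outside \<open>X\<close>, and \<open>\<sigma>\<close> itself
  by the constant \<open>1\<close>, makes the cycle set identity and the injectivity of the diagonal hold on the
  whole type, free of membership conditions.\<close>

locale perm_cycle_set =
  fixes X :: "'a set" and s :: "'a \<Rightarrow> 'a perm"
  assumes finite_X: "finite X"
    and affected_s: "affected (s x) \<subseteq> X"
    and s_outside: "x \<notin> X \<Longrightarrow> s x = 1"
    and cycle: "s x * s (inverse (s x) \<langle>$\<rangle> y) = s y * s (inverse (s y) \<langle>$\<rangle> x)"
    and diagonal: "inj (\<lambda>x. inverse (s x) \<langle>$\<rangle> x)"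
begin

text \<open>This is how \<open>\<lambda>\<close> changes when \<open>y\<close> is added to a multiset \<open>M\<close> with \<open>\<lambda> M = p\<close>: one has
  \<open>M + {#y#} = M \<circ> {#p\<inverse> y#}\<close>, so \<open>\<lambda>\<close> has to be multiplied by \<open>\<sigma> (p\<inverse> y)\<close>.\<close>

definition step :: "'a \<Rightarrow> 'a perm \<Rightarrow> 'a perm" where
  "step y p = p * s (inverse p \<langle>$\<rangle> y)"

text \<open>Adding first \<open>y\<close> and then \<open>z\<close> multiplies \<open>p\<close> by one side of the cycle set identity for
  \<open>p\<inverse> y\<close> and \<open>p\<inverse> z\<close>; the other order gives the other side.\<close>

lemma step_commute: "step z (step y p) = step y (step z p)"
proof -
  have expand: "step v (step u p) = p * (s (inverse p \<langle>$\<rangle> u) *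
      s (inverse (s (inverse p \<langle>$\<rangle> u)) \<langle>$\<rangle> (inverse p \<langle>$\<rangle> v)))" for u v
    by (simp add: step_def apply_times mult.assoc)
  show ?thesis
    unfolding expand by (simp only: cycle[of "inverse p \<langle>$\<rangle> y"])
qed

sublocale step: comp_fun_commute step
  by standard (simp add: fun_eq_iff step_commute)

text \<open>Equivariance under left multiplication: the source of the multiplicativity of \<open>\<lambda>\<close>.\<close>

lemma step_shift: "step (p \<langle>$\<rangle> z) (p * q) = p * step z q"
  by (simp add: step_def apply_times mult.assoc)

text \<open>Iterates starting anywhere are controlled by iterates starting at \<open>1\<close>, so a period at \<open>1\<close> that is
  common to all steps is a period everywhere.\<close>

lemma step_translate: "(step z ^^ k) p = p * (step (inverse p \<langle>$\<rangle> z) ^^ k) 1"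
proof -
  have "(step (p \<langle>$\<rangle> u) ^^ k) (p * q) = p * (step u ^^ k) q" for u q
    by (induction k) (simp_all add: step_shift)
  from this[of "inverse p \<langle>$\<rangle> z" 1] show ?thesis by simp
qed

text \<open>Applying the inverse of \<open>step y p\<close> to \<open>y\<close> gives \<open>\<sigma> u\<inverse> u\<close> with \<open>u = p\<inverse> y\<close>. The diagonal map is
  injective, so \<open>u\<close> can be recovered, and with it \<open>p\<close>.\<close>

lemma inj_step: "inj (step y)"
proof (rule injI)
  fix p q assume eq: "step y p = step y q"
  let ?u = "inverse p \<langle>$\<rangle> y" and ?v = "inverse q \<langle>$\<rangle> y"
  have "inverse (step y p) \<langle>$\<rangle> y = inverse (step y q) \<langle>$\<rangle> y"
    by (simp add: eq)
  then have "inverse (s ?u) \<langle>$\<rangle> ?u = inverse (s ?v) \<langle>$\<rangle> ?v"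
    by (simp add: step_def apply_times)
  then have "?u = ?v"
    using diagonal by (rule injD[rotated])
  with eq show "p = q"
    by (simp add: step_def perm.right_cancel)
qed

lemma affected_step: "affected p \<subseteq> X \<Longrightarrow> affected (step y p) \<subseteq> X"
  unfolding step_def
  using affected_times[of p "s (inverse p \<langle>$\<rangle> y)"] affected_s[of "inverse p \<langle>$\<rangle> y"] by blast

text \<open>The iterates of \<open>1\<close> stay among the finitely many permutations of \<open>X\<close>; injectivity turns the first
  repetition into a return to \<open>1\<close>.\<close>

lemma step_power_returns: "\<exists>k>0. (step x ^^ k) 1 = 1"
proof -
  have "affected ((step x ^^ k) 1) \<subseteq> X" for k
    by (induction k) (simp_all add: affected_step)
  then have "finite (range (\<lambda>k. (step x ^^ k) 1))"
    by (intro finite_subset[OF _ finite_perms_on[OF finite_X]]) auto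
  then have "\<not> inj (\<lambda>k. (step x ^^ k) 1)"
    using finite_imageD infinite_UNIV_nat by blast
  then obtain i j where "i < j" and ij: "(step x ^^ i) 1 = (step x ^^ j) 1"
    unfolding inj_on_def by (metis nat_neq_iff)
  then have "(step x ^^ i) 1 = (step x ^^ i) ((step x ^^ (j - i)) 1)"
    by (metis comp_apply funpow_add le_add_diff_inverse less_imp_le)
  moreover have "inj (step x ^^ i)"
    by (simp add: inj_step inj_fn)
  ultimately have "(step x ^^ (j - i)) 1 = 1"
    by (metis injD)
  then show ?thesis
    using \<open>i < j\<close> by (intro exI[of _ "j - i"]) auto
qed

lemma common_period: "\<exists>m\<ge>2. \<forall>x. (step x ^^ m) 1 = 1"
proof -
  obtain k where k: "\<And>x. 0 < k x" "\<And>x. (step x ^^ k x) 1 = 1"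
    using step_power_returns by metis
  \<comment> \<open>The factor 2 makes the period at least 2.\<close>
  let ?m = "2 * (\<Prod>x\<in>X. k x)"
  have "(step x ^^ ?m) 1 = 1" for x
  proof (cases "x \<in> X")
    case True
    then have "k x dvd ?m"
      by (simp add: dvd_prodI finite_X)
    then obtain n where "?m = k x * n"
      by (rule dvdE)
    then show ?thesis
      using funpow_fixpoint_mult[OF k(2)] by simp
  next
    case False
    then have "(step x ^^ 1) 1 = 1"
      by (simp add: step_def s_outside)
    from funpow_fixpoint_mult[OF this, of ?m] show ?thesis
      by (simp only: mult_1)
  qed
  moreover have "(\<Prod>x\<in>X. k x) \<ge> 1"
    using k(1) by (simp add: Suc_le_eq prod_pos)
  ultimately show ?thesis
    by (intro exI[of _ ?m]) auto
qed

definition lam :: "'a multiset \<Rightarrow> 'a perm" where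
  "lam M = fold_mset step 1 M"

definition circ :: "'a multiset \<Rightarrow> 'a multiset \<Rightarrow> 'a multiset" where
  "circ M N = M + image_mset (apply (lam M)) N"

lemma lam_empty [simp]: "lam {#} = 1"
  by (simp add: lam_def)

lemma lam_single [simp]: "lam {#x#} = s x"
  by (simp add: lam_def step_def)

lemma fold_step_shift:
  "fold_mset step (p * q) (image_mset (apply p) N) = p * fold_mset step q N"
  by (induction N) (simp_all add: step_shift)

text \<open>The elements of \<open>\<lambda> M (N)\<close> act on \<open>\<lambda> M\<close> as those of \<open>N\<close> act on \<open>1\<close>, translated by \<open>\<lambda> M\<close>.\<close>

lemma lam_circ: "lam (circ M N) = lam M * lam N"
  using fold_step_shift[of "lam M" 1 N] by (simp add: circ_def lam_def)

lemma circ_assoc: "circ (circ M N) P = circ M (circ N P)"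
  unfolding circ_def[of "circ M N"] lam_circ
  by (simp add: circ_def apply_times multiset.map_comp add.assoc)

lemma circ_empty_left [simp]: "circ {#} M = M"
  by (simp add: circ_def)

lemma circ_distrib: "circ M (N + P) + M = circ M N + circ M P"
  by (simp add: circ_def ac_simps)

lemma affected_lam: "affected (lam M) \<subseteq> X"
  by (induction M) (simp_all add: lam_def affected_step)

lemma set_circ:
  assumes "set_mset M \<subseteq> X" "set_mset N \<subseteq> X"
  shows "set_mset (circ M N) \<subseteq> X"
  using assms perm_apply_mem[OF affected_lam] by (auto simp: circ_def)

end

section \<open>Reduction modulo a common period\<close>

text \<open>The function \<open>code\<close> is a name for the class of a multiset modulo \<open>m\<close>. Encoding the classes as natural
  numbers performs the passage to the quotient and the choice of the carrier type in one step.\<close>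

locale reduced_cycle_set = perm_cycle_set X s
  for X :: "'a set" and s :: "'a \<Rightarrow> 'a perm" +
  fixes m :: nat and code :: "'a multiset \<Rightarrow> nat"
  assumes m_ge_2: "m \<ge> 2"
    and period: "(step x ^^ m) 1 = 1"
    and code_eq_iff: "set_mset M \<subseteq> X \<Longrightarrow> set_mset N \<subseteq> X \<Longrightarrow>
      code M = code N \<longleftrightarrow> (\<forall>x. count M x mod m = count N x mod m)"
begin

lemma fold_step_repeat: "fold_mset step p (repeat_mset m M) = p"
proof (induction M arbitrary: p)
  case empty
  then show ?case by simp
next
  case (add x M)
  have "fold_mset step q (replicate_mset k x) = (step x ^^ k) q" for q k
    by (induction k) simp_all
  then have "fold_mset step p (replicate_mset m x) = p"
    by (simp add: step_translate[of m x p] period)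
  with add show ?case by simp
qed

text \<open>\<open>M\<close> and \<open>N\<close> have the same remainder modulo \<open>m\<close>, and by periodicity a multiple of \<open>m\<close> acts trivially.\<close>

lemma lam_cong:
  assumes "\<And>x. count M x mod m = count N x mod m"
  shows "lam M = lam N"
proof -
  obtain R Q where R: "\<And>x. count R x = count M x mod m" "M = R + repeat_mset m Q"
    using mset_quotient_remainder[of M m] by blast
  obtain R' Q' where R': "\<And>x. count R' x = count N x mod m" "N = R' + repeat_mset m Q'"
    using mset_quotient_remainder[of N m] by blast
  have "R = R'"
    by (rule multiset_eqI) (simp add: R(1) R'(1) assms)
  then show ?thesis
    by (simp add: lam_def R(2) R'(2) fold_step_repeat)
qed

definition decode :: "nat \<Rightarrow> 'a multiset" where
  "decode = inv_into {M. set_mset M \<subseteq> X} code"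

definition brace :: "nat ring" where
  "brace = \<lparr>carrier = code ` {M. set_mset M \<subseteq> X},
     monoid.mult = (\<lambda>u v. code (circ (decode u) (decode v))), one = code {#},
     zero = code {#}, add = (\<lambda>u v. code (decode u + decode v))\<rparr>"

lemma decode_code:
  assumes "set_mset M \<subseteq> X"
  shows "set_mset (decode (code M)) \<subseteq> X" "count (decode (code M)) x mod m = count M x mod m"
proof -
  let ?C = "{M. set_mset M \<subseteq> X}"
  have M: "code M \<in> code ` ?C"
    using assms by blast
  show *: "set_mset (decode (code M)) \<subseteq> X"
    using inv_into_into[OF M] by (simp add: decode_def)
  have "code (decode (code M)) = code M"
    using f_inv_into_f[OF M] by (simp add: decode_def)
  then show "count (decode (code M)) x mod m = count M x mod m"
    using * assms code_eq_iff by blast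
qed

lemma add_code:
  assumes "set_mset M \<subseteq> X" "set_mset N \<subseteq> X"
  shows "code M \<oplus>\<^bsub>brace\<^esub> code N = code (M + N)"
proof -
  have "(count (decode (code M)) x + count (decode (code N)) x) mod m = (count M x + count N x) mod m" for x
    using assms by (intro mod_add_cong decode_code)
  then show ?thesis
    using assms decode_code(1) by (simp add: brace_def code_eq_iff)
qed

lemma mult_code:
  assumes "set_mset M \<subseteq> X" "set_mset N \<subseteq> X"
  shows "code M \<otimes>\<^bsub>brace\<^esub> code N = code (circ M N)"
proof -
  let ?M = "decode (code M)" and ?N = "decode (code N)"
  have "lam ?M = lam M"
    using assms by (intro lam_cong decode_code)
  then have "count (circ ?M ?N) x mod m = count (circ M N) x mod m" for x
    unfolding circ_def count_union count_image_perm
    using assms by (simp only:) (intro mod_add_cong decode_code)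
  then show ?thesis
    using assms decode_code(1) by (simp add: brace_def code_eq_iff set_circ)
qed

lemma carrier_brace: "carrier brace = code ` {M. set_mset M \<subseteq> X}"
  and one_brace: "\<one>\<^bsub>brace\<^esub> = code {#}"
  and zero_brace: "\<zero>\<^bsub>brace\<^esub> = code {#}"
  by (simp_all add: brace_def)

lemma carrier_braceE:
  assumes "u \<in> carrier brace"
  obtains M where "set_mset M \<subseteq> X" "u = code M"
  using assms by (auto simp: carrier_brace)

lemma carrier_brace_all:
  "(\<forall>u\<in>carrier brace. Q u) \<longleftrightarrow> (\<forall>M. set_mset M \<subseteq> X \<longrightarrow> Q (code M))"
  by (auto simp: carrier_brace)

lemma code_mem_carrier: "set_mset M \<subseteq> X \<Longrightarrow> code M \<in> carrier brace"
  by (auto simp: carrier_brace)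

lemma code_repeat: "set_mset M \<subseteq> X \<Longrightarrow> code (repeat_mset m M) = code {#}"
  using set_repeat_mset_subset[of m M] by (subst code_eq_iff) auto

lemma neg_code:
  "set_mset M \<subseteq> X \<Longrightarrow> code (M + repeat_mset (m - 1) M) = code {#}"
  using code_repeat[of M] m_ge_2 by (cases m) simp_all

lemma abelian_group_brace: "abelian_group brace"
proof (rule abelian_groupI)
  fix u assume "u \<in> carrier brace"
  then obtain M where M: "set_mset M \<subseteq> X" "u = code M"
    by (rule carrier_braceE)
  have N: "set_mset (repeat_mset (m - 1) M) \<subseteq> X"
    using M set_repeat_mset_subset[of "m - 1" M] by blast
  then have "code (repeat_mset (m - 1) M) \<oplus>\<^bsub>brace\<^esub> u = \<zero>\<^bsub>brace\<^esub>"
    using M neg_code[of M] by (simp add: add_code zero_brace add.commute)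
  then show "\<exists>v\<in>carrier brace. v \<oplus>\<^bsub>brace\<^esub> u = \<zero>\<^bsub>brace\<^esub>"
    using N code_mem_carrier by blast
qed (auto elim!: carrier_braceE simp: add_code zero_brace code_mem_carrier ac_simps)

text \<open>Since \<open>M \<circ> \<lambda> M\<inverse> (K) = M + K\<close>, a right inverse arises by twisting the additive inverse
  \<open>K = (m - 1) M\<close>.\<close>

lemma right_inverse_brace:
  assumes "u \<in> carrier brace"
  shows "\<exists>v\<in>carrier brace. u \<otimes>\<^bsub>brace\<^esub> v = \<one>\<^bsub>brace\<^esub>"
proof -
  obtain M where M: "set_mset M \<subseteq> X" "u = code M"
    using assms by (rule carrier_braceE)
  define N where "N = image_mset (apply (inverse (lam M))) (repeat_mset (m - 1) M)"
  have N: "set_mset N \<subseteq> X"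
    using M perm_apply_mem[of "inverse (lam M)" X] affected_lam
      set_repeat_mset_subset[of "m - 1" M]
    by (auto simp: N_def)
  have "circ M N = M + repeat_mset (m - 1) M"
    by (simp add: circ_def N_def multiset.map_comp comp_def)
  then have "u \<otimes>\<^bsub>brace\<^esub> code N = \<one>\<^bsub>brace\<^esub>"
    using M N neg_code[of M] by (simp add: mult_code one_brace)
  then show ?thesis
    using N code_mem_carrier by blast
qed

lemma group_brace: "group brace"
proof -
  have closed: "\<forall>u\<in>carrier brace. \<forall>v\<in>carrier brace. u \<otimes>\<^bsub>brace\<^esub> v \<in> carrier brace"
    by (simp add: carrier_brace_all mult_code code_mem_carrier set_circ)
  have assoc: "\<forall>u\<in>carrier brace. \<forall>v\<in>carrier brace. \<forall>w\<in>carrier brace.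
      u \<otimes>\<^bsub>brace\<^esub> v \<otimes>\<^bsub>brace\<^esub> w = u \<otimes>\<^bsub>brace\<^esub> (v \<otimes>\<^bsub>brace\<^esub> w)"
    by (simp add: carrier_brace_all mult_code set_circ circ_assoc)
  have l_one: "\<forall>u\<in>carrier brace. \<one>\<^bsub>brace\<^esub> \<otimes>\<^bsub>brace\<^esub> u = u"
    by (simp add: carrier_brace_all mult_code one_brace)
  have r_one: "\<forall>u\<in>carrier brace. u \<otimes>\<^bsub>brace\<^esub> \<one>\<^bsub>brace\<^esub> = u"
    by (simp add: carrier_brace_all mult_code one_brace circ_def)
  \<comment> \<open>If \<open>v\<close> is a right inverse of \<open>u\<close> and \<open>w\<close> one of \<open>v\<close>, then \<open>w = u\<close>, so \<open>v\<close> is a left inverse as well.\<close>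
  have l_inv: "\<exists>v\<in>carrier brace. v \<otimes>\<^bsub>brace\<^esub> u = \<one>\<^bsub>brace\<^esub>" if u: "u \<in> carrier brace" for u
  proof -
    obtain v where v: "v \<in> carrier brace" "u \<otimes>\<^bsub>brace\<^esub> v = \<one>\<^bsub>brace\<^esub>"
      using right_inverse_brace[OF u] by blast
    obtain w where w: "w \<in> carrier brace" "v \<otimes>\<^bsub>brace\<^esub> w = \<one>\<^bsub>brace\<^esub>"
      using right_inverse_brace[OF v(1)] by blast
    have "u = u \<otimes>\<^bsub>brace\<^esub> (v \<otimes>\<^bsub>brace\<^esub> w)"
      by (simp only: w(2) r_one[rule_format, OF u])
    also have "\<dots> = u \<otimes>\<^bsub>brace\<^esub> v \<otimes>\<^bsub>brace\<^esub> w"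
      using u v(1) w(1) by (simp only: assoc)
    also have "\<dots> = w"
      by (simp only: v(2) l_one[rule_format, OF w(1)])
    finally have "v \<otimes>\<^bsub>brace\<^esub> u = \<one>\<^bsub>brace\<^esub>"
      by (simp only: w(2))
    then show ?thesis
      using v(1) ..
  qed
  have one_mem: "\<one>\<^bsub>brace\<^esub> \<in> carrier brace"
    by (simp add: one_brace code_mem_carrier)
  show ?thesis
  proof (rule groupI)
    fix u v w
    assume u: "u \<in> carrier brace"
    show "\<one>\<^bsub>brace\<^esub> \<otimes>\<^bsub>brace\<^esub> u = u"
      using u l_one by blast
    show "\<exists>v\<in>carrier brace. v \<otimes>\<^bsub>brace\<^esub> u = \<one>\<^bsub>brace\<^esub>"
      using u by (rule l_inv)
    assume v: "v \<in> carrier brace"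
    show "u \<otimes>\<^bsub>brace\<^esub> v \<in> carrier brace"
      using u v closed by blast
    assume w: "w \<in> carrier brace"
    show "u \<otimes>\<^bsub>brace\<^esub> v \<otimes>\<^bsub>brace\<^esub> w = u \<otimes>\<^bsub>brace\<^esub> (v \<otimes>\<^bsub>brace\<^esub> w)"
      using u v w assoc by blast
  qed (rule one_mem)
qed

lemma left_brace_brace: "left_brace brace"
proof (rule left_brace.intro[OF abelian_group_brace group_brace left_brace_axioms.intro])
  fix a b c
  assume "a \<in> carrier brace"
  then obtain M where M: "set_mset M \<subseteq> X" "a = code M"
    by (rule carrier_braceE)
  assume "b \<in> carrier brace"
  then obtain N where N: "set_mset N \<subseteq> X" "b = code N"
    by (rule carrier_braceE)
  assume "c \<in> carrier brace"
  then obtain P where P: "set_mset P \<subseteq> X" "c = code P"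
    by (rule carrier_braceE)
  show "a \<otimes>\<^bsub>brace\<^esub> (b \<oplus>\<^bsub>brace\<^esub> c) \<oplus>\<^bsub>brace\<^esub> a
      = a \<otimes>\<^bsub>brace\<^esub> b \<oplus>\<^bsub>brace\<^esub> a \<otimes>\<^bsub>brace\<^esub> c"
    using M N P by (simp add: mult_code add_code set_circ circ_distrib)
qed

lemma finite_brace: "finite (carrier brace)"
proof -
  let ?C = "{M. set_mset M \<subseteq> X}"
  \<comment> \<open>A code depends only on the residues of the multiplicities, which are finitely many functions.\<close>
  let ?g = "\<lambda>M. \<lambda>x\<in>X. count M x mod m"
  have "?g ` ?C \<subseteq> X \<rightarrow>\<^sub>E {..<m}"
    using m_ge_2 by auto
  then have "finite (?g ` ?C)"
    by (rule finite_subset) (simp add: finite_PiE finite_X)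
  moreover have "code M = code N" if "M \<in> ?C" "N \<in> ?C" "?g M = ?g N" for M N
  proof -
    have "count M x mod m = count N x mod m" for x
    proof (cases "x \<in> X")
      case True
      then show ?thesis using fun_cong[OF that(3), of x] by simp
    next
      case False
      with that have "x \<notin># M" "x \<notin># N" by auto
      then show ?thesis by (simp add: not_in_iff)
    qed
    then show ?thesis using that by (simp add: code_eq_iff)
  qed
  then have "code M = code (inv_into ?C ?g (?g M))" if "M \<in> ?C" for M
    using that by (metis (mono_tags, lifting) f_inv_into_f imageI inv_into_into)
  then have "code ` ?C \<subseteq> (\<lambda>f. code (inv_into ?C ?g f)) ` (?g ` ?C)"
    by blast
  ultimately show ?thesis
    unfolding carrier_brace using finite_surj by blast
qed

lemma generate_brace:
  "generate (add_monoid brace) ((\<lambda>x. code {#x#}) ` X) = carrier brace"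
proof
  interpret abelian_group brace by (rule abelian_group_brace)
  have "(\<lambda>x. code {#x#}) ` X \<subseteq> carrier (add_monoid brace)"
    by (auto intro: code_mem_carrier)
  then show "generate (add_monoid brace) ((\<lambda>x. code {#x#}) ` X) \<subseteq> carrier brace"
    using add.generate_incl by simp
  have "code M \<in> generate (add_monoid brace) ((\<lambda>x. code {#x#}) ` X)"
    if "set_mset M \<subseteq> X" for M
    using that
  proof (induction M)
    case empty
    then show ?case
      using generate.one[of "add_monoid brace"] by (simp add: zero_brace)
  next
    case (add x M)
    then have "code {#x#} \<oplus>\<^bsub>brace\<^esub> code M \<in> generate (add_monoid brace) ((\<lambda>x. code {#x#}) ` X)"
      using generate.eng[of _ "add_monoid brace"] by (simp add: generate.incl)
    then show ?case
      using add by (simp add: add_code)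
  qed
  then show "carrier brace \<subseteq> generate (add_monoid brace) ((\<lambda>x. code {#x#}) ` X)"
    by (auto elim: carrier_braceE)
qed

lemma inj_generators: "inj_on (\<lambda>x. code {#x#}) X"
proof (rule inj_onI)
  fix x y assume "x \<in> X" "y \<in> X" "code {#x#} = code {#y#}"
  then have "\<forall>z. count {#x#} z mod m = count {#y#} z mod m"
    using code_eq_iff[of "{#x#}" "{#y#}"] by simp
  then have "count {#x#} x mod m = count {#y#} x mod m" ..
  then show "x = y"
    using m_ge_2 by (auto split: if_splits)
qed

text \<open>Both products of generators have the form \<open>{#u#} \<circ> {#v#} = {#u#} + {#\<sigma> u v#}\<close>, so both equal
  \<open>{#x#} + {#c#}\<close>.\<close>

lemma brace_sol_generators:
  assumes "x \<in> X" "y \<in> X" "d \<in> X" and c: "s x \<langle>$\<rangle> y = c" and d: "s c \<langle>$\<rangle> d = x"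
  shows "brace_sol brace (code {#x#}, code {#y#}) = (code {#c#}, code {#d#})"
proof -
  interpret left_brace brace by (rule left_brace_brace)
  have "c \<in> X"
    using perm_apply_mem[OF affected_s assms(2), of x] c by simp
  then show ?thesis
    using assms by (intro brace_sol_eqI)
      (auto intro: code_mem_carrier simp: mult_code add_code circ_def add_mset_commute)
qed

end

section \<open>The cycle set of a finite solution\<close>

locale finite_yb_solution = yb_solution X r
  for X :: "'a set" and r :: "'a \<times> 'a \<Rightarrow> 'a \<times> 'a" +
  assumes finite_X: "finite X"
begin

definition sigma :: "'a \<Rightarrow> 'a perm" where
  "sigma x = (if x \<in> X then Perm (\<lambda>y. if y \<in> X then fst (r (x, y)) else y) else 1)"

lemma sigma_apply:
  assumes "x \<in> X"
  shows "sigma x \<langle>$\<rangle> y = (if y \<in> X then fst (r (x, y)) else y)"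
proof -
  let ?f = "\<lambda>y. if y \<in> X then fst (r (x, y)) else y"
  have "bij_betw ?f X X"
    using nondeg_left[OF assms] by (rule bij_betw_cong[THEN iffD1, rotated]) simp
  moreover have "bij_betw ?f (- X) (- X)"
    by (rule bij_betw_cong[THEN iffD1, OF _ bij_betw_id]) simp
  ultimately have "bij_betw ?f (X \<union> - X) (X \<union> - X)"
    by (rule bij_betw_combine) simp
  then have "bij ?f"
    by simp
  moreover have "finite {a. ?f a \<noteq> a}"
    by (rule finite_subset[OF _ finite_X]) auto
  ultimately show ?thesis
    using assms by (simp add: sigma_def Perm_inverse)
qed

lemma affected_sigma: "affected (sigma x) \<subseteq> X"
proof (cases "x \<in> X")
  case True
  then show ?thesis by (auto simp: in_affected sigma_apply split: if_splits)
next
  case False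
  then show ?thesis by (simp add: sigma_def)
qed

lemma r_mem:
  assumes "x \<in> X" "y \<in> X" "r (x, y) = (c, d)"
  shows "c \<in> X" "d \<in> X"
  using assms maps by (metis PiE mem_Sigma_iff)+

text \<open>The second equation is the first component of \<open>r (r (x, y)) = (x, y)\<close>.\<close>

lemma sigma_involutive:
  assumes "x \<in> X" "y \<in> X" "r (x, y) = (c, d)"
  shows "sigma x \<langle>$\<rangle> y = c" "sigma c \<langle>$\<rangle> d = x"
  using assms r_mem[OF assms] involutive[of "(x, y)"] by (simp_all add: sigma_apply)

text \<open>The first components of the two sides of the braid relation at \<open>(x, y, z)\<close> are \<open>\<sigma> c (\<sigma> d z)\<close> and
  \<open>\<sigma> x (\<sigma> y z)\<close>.\<close>

lemma sigma_braid:
  assumes xy: "x \<in> X" "y \<in> X" "r (x, y) = (c, d)"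
  shows "sigma x * sigma y = sigma c * sigma d"
proof (rule perm_eqI)
  fix z
  note cd = r_mem[OF xy]
  show "(sigma x * sigma y) \<langle>$\<rangle> z = (sigma c * sigma d) \<langle>$\<rangle> z"
  proof (cases "z \<in> X")
    case True
    have fst_eq: "fst (r (u, v)) = sigma u \<langle>$\<rangle> v" if "u \<in> X" "v \<in> X" for u v
      using that by (simp add: sigma_apply)
    have mem: "sigma u \<langle>$\<rangle> v \<in> X" if "v \<in> X" for u v
      using perm_apply_mem[OF affected_sigma that] .
    have "fst (on12 r (on23 r (on12 r (x, y, z)))) = sigma c \<langle>$\<rangle> (sigma d \<langle>$\<rangle> z)"
      using True xy cd by (auto simp: on12_def on23_def split: prod.split)
         (metis fst_conv fst_eq mem)
    moreover have "fst (on23 r (on12 r (on23 r (x, y, z)))) = sigma x \<langle>$\<rangle> (sigma y \<langle>$\<rangle> z)"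
      using True xy by (auto simp: on12_def on23_def split: prod.split)
         (metis fst_conv fst_eq mem)
    ultimately show ?thesis
      using braid[of "(x, y, z)"] True xy by (simp add: apply_times)
  next
    case False
    then show ?thesis
      using xy cd by (simp add: apply_times sigma_apply)
  qed
qed

text \<open>Since \<open>\<sigma> x\<close> and \<open>\<sigma> c\<close> are invertible, a pair \<open>(x, y)\<close> and its image \<open>(c, d)\<close> are determined by
  \<open>x\<close> and \<open>c\<close>, and the roles of these two are symmetric.\<close>

lemma sigma_inverse:
  assumes "x \<in> X" "c \<in> X"
  obtains d where "d \<in> X" "r (x, inverse (sigma x) \<langle>$\<rangle> c) = (c, d)"
    "inverse (sigma x) \<langle>$\<rangle> c \<in> X" "d = inverse (sigma c) \<langle>$\<rangle> x"
proof -
  let ?y = "inverse (sigma x) \<langle>$\<rangle> c"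
  have y: "?y \<in> X"
    using perm_apply_mem[of "inverse (sigma x)" X] affected_sigma assms by simp
  obtain c' d where r: "r (x, ?y) = (c', d)"
    by fastforce
  have "c' = c"
    using sigma_involutive(1)[OF assms(1) y r] by simp
  moreover have "d = inverse (sigma c') \<langle>$\<rangle> x"
    using sigma_involutive(2)[OF assms(1) y r] by (metis perm_inverse_apply)
  ultimately show thesis
    using that r_mem[OF assms(1) y r] r y by blast
qed

text \<open>For \<open>x\<close> and \<open>y\<close> in \<open>X\<close>, this is \<open>sigma_braid\<close> for the pair with first component \<open>x\<close> whose image
  has first component \<open>y\<close>.\<close>

lemma sigma_cycle:
  "sigma x * sigma (inverse (sigma x) \<langle>$\<rangle> y) = sigma y * sigma (inverse (sigma y) \<langle>$\<rangle> x)"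
proof -
  have outside: "sigma u * sigma (inverse (sigma u) \<langle>$\<rangle> v) = sigma v * sigma (inverse (sigma v) \<langle>$\<rangle> u)"
    if "v \<notin> X" for u v
  proof -
    have "inverse (sigma u) \<langle>$\<rangle> v = v"
      using that affected_sigma[of u] affected_inverse[of "sigma u"] by (metis in_affected subsetD)
    then show ?thesis
      using that by (simp add: sigma_def[of v])
  qed
  show ?thesis
  proof (cases "x \<in> X \<and> y \<in> X")
    case True
    then obtain d where "r (x, inverse (sigma x) \<langle>$\<rangle> y) = (y, d)"
      "inverse (sigma x) \<langle>$\<rangle> y \<in> X" "d = inverse (sigma y) \<langle>$\<rangle> x"
      using sigma_inverse by metis
    then show ?thesis
      using sigma_braid True by blast
  next
    case False
    then show ?thesis using outside by metis
  qed
qed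

text \<open>The pair \<open>(x, \<sigma> x\<inverse> x)\<close> is a fixed point of \<open>r\<close>. If \<open>x\<close> and \<open>x'\<close> have the same diagonal value \<open>t\<close>,
  then the second components of \<open>r (x, t)\<close> and \<open>r (x', t)\<close> are both \<open>t\<close>, and right non-degeneracy
  gives \<open>x = x'\<close>.\<close>

lemma sigma_diagonal: "inj (\<lambda>x. inverse (sigma x) \<langle>$\<rangle> x)"
proof (rule injI)
  fix x x'
  let ?T = "\<lambda>x. inverse (sigma x) \<langle>$\<rangle> x"
  assume eq: "?T x = ?T x'"
  have r_diag: "r (u, ?T u) = (u, ?T u) \<and> ?T u \<in> X" if "u \<in> X" for u
    using sigma_inverse[OF that that] by metis
  have out: "?T u = u" if "u \<notin> X" for u
    using that by (simp add: sigma_def)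
  show "x = x'"
  proof (cases "x \<in> X")
    case True
    then have "x' \<in> X"
      using r_diag eq out by metis
    then have "snd (r (x, ?T x)) = snd (r (x', ?T x))"
      using r_diag True eq by (metis snd_conv)
    then show ?thesis
      using nondeg_right[of "?T x"] r_diag True \<open>x' \<in> X\<close>
      by (simp add: bij_betw_def inj_on_def)
  next
    case False
    then show ?thesis
      using r_diag eq out by metis
  qed
qed

sublocale perm_cycle_set X sigma
proof
  show "sigma x = 1" if "x \<notin> X" for x
    using that by (simp add: sigma_def)
qed (rule finite_X affected_sigma sigma_cycle sigma_diagonal)+

end

theorem proposition6:
  fixes X :: "'a set" and r :: "'a \<times> 'a \<Rightarrow> 'a \<times> 'a"
  assumes "yb_solution X r" and "finite X"
  shows "\<exists>(B :: nat ring) (i :: 'a \<Rightarrow> nat).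
           left_brace B \<and> finite (carrier B) \<and>
           inj_on i X \<and> i ` X \<subseteq> carrier B \<and>
           generate (add_monoid B) (i ` X) = carrier B \<and>
           subsolution_via i X r (carrier B) (brace_sol B)"
proof -
  interpret finite_yb_solution X r
    using assms by (intro finite_yb_solution.intro finite_yb_solution_axioms.intro)
  obtain m where m: "m \<ge> 2" "\<And>x. (step x ^^ m) 1 = 1"
    using common_period by blast
  obtain f :: "('a \<Rightarrow> nat) \<Rightarrow> nat" where f: "inj_on f (X \<rightarrow>\<^sub>E {..<m})"
    using finite_imp_inj_to_nat_seg[of "X \<rightarrow>\<^sub>E {..<m}"] finite_X by (auto simp: finite_PiE)
  define code where "code M = f (\<lambda>x\<in>X. count M x mod m)" for M
  interpret reduced_cycle_set X sigma m code
  proof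
    fix M N :: "'a multiset"
    assume MN: "set_mset M \<subseteq> X" "set_mset N \<subseteq> X"
    let ?g = "\<lambda>M. \<lambda>x\<in>X. count M x mod m"
    have "?g M \<in> X \<rightarrow>\<^sub>E {..<m}" for M
      using m by auto
    then have "code M = code N \<longleftrightarrow> ?g M = ?g N"
      unfolding code_def by (intro inj_on_eq_iff[OF f])
    also have "\<dots> \<longleftrightarrow> (\<forall>x\<in>X. count M x mod m = count N x mod m)"
      by (metis (mono_tags, lifting) restrict_apply' restrict_ext)
    also have "\<dots> \<longleftrightarrow> (\<forall>x. count M x mod m = count N x mod m)"
      using MN by (metis not_in_iff subsetD)
    finally show "code M = code N \<longleftrightarrow> (\<forall>x. count M x mod m = count N x mod m)" .
  qed (use m in auto)
  let ?i = "\<lambda>x. code {#x#}"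
  have i: "inj_on ?i X" "?i ` X \<subseteq> carrier brace"
    by (auto intro: inj_generators code_mem_carrier)
  have sol: "brace_sol brace (?i x, ?i y) = map_prod ?i ?i (r (x, y))" if xy: "x \<in> X" "y \<in> X" for x y
  proof -
    obtain c d where r: "r (x, y) = (c, d)"
      by (rule prod.exhaust)
    show ?thesis
      using brace_sol_generators[OF xy r_mem(2)[OF xy r] sigma_involutive[OF xy r]] r by simp
  qed
  have "subsolution_via ?i X r (carrier brace) (brace_sol brace)"
    unfolding subsolution_via_def
  proof (intro conjI i ballI subsetI sol)
    fix p assume "p \<in> brace_sol brace ` (?i ` X \<times> ?i ` X)"
    then obtain x y where xy: "x \<in> X" "y \<in> X" and "p = brace_sol brace (?i x, ?i y)"
      by blast
    then have p: "p = map_prod ?i ?i (r (x, y))"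
      by (simp only: sol)
    have "r (x, y) \<in> X \<times> X"
      using maps xy by blast
    then show "p \<in> ?i ` X \<times> ?i ` X"
      unfolding p by (cases "r (x, y)") auto
  qed
  then show ?thesis
    using left_brace_brace finite_brace generate_brace i by blast
qed

end
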